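(* Let $H_0,\dots,H_m\in\mathbb{R}^{n\times n}$ be symmetric matrices. If the set $\mathcal{X}_T$ is not empty, then the set $\mathcal{X}_3$ is not empty.
   Context: Let $\mathbb{S}^n$ be the set of real symmetric $n\times n$ matrices, let $X\ge 0$ mean positive semidefinite, and let $G(\delta)=H_0+\sum_{i=1}^m\delta_iH_i$ for $\delta\in\mathbb{R}^m$. $\mathcal{X}_T\subset\mathbb{S}^n\times\cdots\times\mathbb{S}^n$ ($m$ factors) is the set of $(X_1,\dots,X_m)$ such that $H_0-\sum_{i=1}^mX_i\ge 0$, and $X_i+H_i\ge 0$ and $X_i-H_i\ge 0$ for all $i=1,\dots,m$. $\mathcal{X}_3$ is the set of tuples $(S_0,S_1,\dots,S_m)$ such that: $S_0$ is a symmetric $n\times n$ polynomial matrix in $\delta=(\delta_1,\dots,\delta_m)$ of total degree at most $2$ which is sum-of-squares (there exist $q$ and a polynomial matrix $T\in\mathbb{R}[\delta]^{n\times q}$ with $S_0(\delta)=T(\delta)T(\delta)^T$); $S_1,\dots,S_m\in\mathbb{S}^n$ are constant symmetric matrices; and, identically in $\delta$, $G(\delta)=S_0(\delta)+\sum_{i=1}^m(1-\delta_i^2)S_i$. *)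

theory Defs
  imports "HOL-Analysis.Analysis" "HOL-Library.Poly_Mapping"
begin

text \<open>
  The index type \<open>'m\<close> plays the role of \<open>{1..m}\<close> and \<open>'n\<close> that of the row and column indices.
  Polynomials in the indeterminates \<open>\<delta>\<^sub>i\<close>, \<open>i :: 'm\<close>, are finitely supported coefficient functions
  on monomials, a monomial being its exponent function; addition and multiplication are the
  (convolution) ring operations of \<^theory>\<open>HOL-Library.Poly_Mapping\<close>.
\<close>

type_synonym 'm rpoly = "('m \<Rightarrow>\<^sub>0 nat) \<Rightarrow>\<^sub>0 real"

definition poly_eval :: "'m::finite rpoly \<Rightarrow> real ^ 'm \<Rightarrow> real" where
  "poly_eval p \<delta> =
     (\<Sum>e\<in>Poly_Mapping.keys p. Poly_Mapping.lookup p e * (\<Prod>i\<in>UNIV. (\<delta> $ i) ^ Poly_Mapping.lookup e i))"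

text \<open>The zero polynomial gets total degree 0, so it satisfies every bound on the total degree.\<close>

definition total_degree :: "'m::finite rpoly \<Rightarrow> nat" where
  "total_degree p =
     Max (insert 0 ((\<lambda>e. \<Sum>i\<in>UNIV. Poly_Mapping.lookup e i) ` Poly_Mapping.keys p))"

definition mat_eval :: "'m::finite rpoly ^ 'n ^ 'n \<Rightarrow> real ^ 'm \<Rightarrow> real ^ 'n ^ 'n" where
  "mat_eval S \<delta> = (\<chi> r c. poly_eval (S $ r $ c) \<delta>)"

definition sym_mat :: "'a ^ 'n ^ 'n \<Rightarrow> bool" where
  "sym_mat A \<longleftrightarrow> transpose A = A"

definition psd :: "real ^ 'n ^ 'n \<Rightarrow> bool" where
  "psd A \<longleftrightarrow> sym_mat A \<and> (\<forall>x. x \<bullet> (A *v x) \<ge> 0)"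

text \<open>
  The number \<open>q\<close> of columns of the factor \<open>T\<close> is existentially quantified, so \<open>T\<close> cannot have a
  type-indexed column dimension: its entries are \<open>T r k\<close> with \<open>k < q\<close>, and the equation is
  \<open>S = T T\<^sup>T\<close> written entrywise.
\<close>

definition sos_mat :: "'m::finite rpoly ^ 'n ^ 'n \<Rightarrow> bool" where
  "sos_mat S \<longleftrightarrow>
     (\<exists>(q::nat) (T :: 'n \<Rightarrow> nat \<Rightarrow> 'm rpoly). S = (\<chi> r c. \<Sum>k<q. T r k * T c k))"

definition G :: "real ^ 'n ^ 'n \<Rightarrow> ('m::finite \<Rightarrow> real ^ 'n ^ 'n) \<Rightarrow> real ^ 'm \<Rightarrow> real ^ 'n ^ 'n" where
  "G H0 H \<delta> = H0 + (\<Sum>i\<in>UNIV. (\<delta> $ i) *\<^sub>R H i)"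

definition X_T :: "real ^ 'n ^ 'n \<Rightarrow> ('m::finite \<Rightarrow> real ^ 'n ^ 'n) \<Rightarrow> ('m \<Rightarrow> real ^ 'n ^ 'n) set" where
  "X_T H0 H =
     {X. (\<forall>i. sym_mat (X i)) \<and> psd (H0 - (\<Sum>i\<in>UNIV. X i)) \<and>
         (\<forall>i. psd (X i + H i) \<and> psd (X i - H i))}"

definition X_3 ::
  "real ^ 'n ^ 'n \<Rightarrow> ('m::finite \<Rightarrow> real ^ 'n ^ 'n) \<Rightarrow> (('m rpoly ^ 'n ^ 'n) \<times> ('m \<Rightarrow> real ^ 'n ^ 'n)) set"
where
  "X_3 H0 H =
     {(S0, S).
        sym_mat S0 \<and> (\<forall>r c. total_degree (S0 $ r $ c) \<le> 2) \<and> sos_mat S0 \<and>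
        (\<forall>i. sym_mat (S i)) \<and>
        (\<forall>\<delta>. G H0 H \<delta> = mat_eval S0 \<delta> + (\<Sum>i\<in>UNIV. (1 - (\<delta> $ i)\<^sup>2) *\<^sub>R S i))}"

end

theory Submission
  imports Defs
begin

text \<open>
  The certificate is \<open>S\<^sub>i = X\<^sub>i / 2\<close>, because
  \<open>X\<^sub>i + \<delta>\<^sub>i H\<^sub>i = (1 - \<delta>\<^sub>i\<^sup>2) X\<^sub>i / 2 + ((1 + \<delta>\<^sub>i) / 2)\<^sup>2 (X\<^sub>i + H\<^sub>i) + ((1 - \<delta>\<^sub>i) / 2)\<^sup>2 (X\<^sub>i - H\<^sub>i)\<close>.
  Summing over \<open>i\<close> and adding \<open>H\<^sub>0 - \<Sum>\<^sub>i X\<^sub>i\<close> expresses \<open>S\<^sub>0\<close> through squares of affine polynomials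
  times positive semidefinite matrices, and each of those factors as \<open>V V\<^sup>T\<close>.
\<close>

section \<open>Positive semidefinite matrices and their factorization\<close>

lemma psd_quadratic_ge_0:
  fixes A :: "real ^ 'n ^ 'n"
  assumes "psd A"
  shows "0 \<le> x \<bullet> (A *v x) + 2 * t * (x \<bullet> column a A) + t\<^sup>2 * A $ a $ a"
proof -
  let ?e = "axis a 1 :: real ^ 'n"
  have Ae: "A *v ?e = column a A"
    by (rule matrix_vector_mult_basis)
  have "?e \<bullet> (A *v x) = (transpose A *v ?e) \<bullet> x"
    using dot_lmul_matrix[of ?e A x] by simp
  also have "\<dots> = x \<bullet> column a A"
    using assms Ae by (simp add: psd_def sym_mat_def inner_commute)
  finally have eA: "?e \<bullet> (A *v x) = x \<bullet> column a A" .
  have ee: "?e \<bullet> column a A = A $ a $ a"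
    by (simp add: inner_axis' column_def)
  \<comment> \<open>The direction \<open>?e\<close> is fixed and \<open>t\<close> stays free:
    positivity of a quadratic in \<open>t\<close> is what the pivot arguments exploit.\<close>
  have "0 \<le> (x + t *\<^sub>R ?e) \<bullet> (A *v (x + t *\<^sub>R ?e))"
    using assms by (auto simp: psd_def)
  also have "A *v (x + t *\<^sub>R ?e) = A *v x + t *\<^sub>R column a A"
    by (simp add: matrix_vector_right_distrib matrix_vector_mult_scaleR Ae)
  finally show ?thesis
    by (simp add: inner_add_left inner_add_right eA ee power2_eq_square algebra_simps)
qed

lemma psd_nth_sym: "psd A \<Longrightarrow> A $ i $ j = A $ j $ i"
  by (auto simp: psd_def sym_mat_def transpose_def vec_eq_iff)

lemma psd_diag_ge_0:
  assumes "psd A"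
  shows "0 \<le> A $ i $ i"
  using psd_quadratic_ge_0[OF assms, of 0 1 i] by simp

text \<open>Without its square term, the quadratic in \<open>t\<close> is affine and can stay
  nonnegative for all \<open>t\<close> only if its slope vanishes.\<close>

lemma psd_zero_diag:
  fixes A :: "real ^ 'n ^ 'n"
  assumes "psd A" "A $ a $ a = 0"
  shows "A $ j $ a = 0"
proof (rule ccontr)
  assume nz: "A $ j $ a \<noteq> 0"
  let ?x = "axis j 1 :: real ^ 'n"
  \<comment> \<open>This \<open>t\<close> makes the affine expression equal to -1.\<close>
  let ?t = "- (A $ j $ j + 1) / (2 * A $ j $ a)"
  have xx: "?x \<bullet> (A *v ?x) = A $ j $ j" "?x \<bullet> column a A = A $ j $ a"
    by (simp_all only: matrix_vector_mult_basis) (simp_all add: inner_axis' column_def)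
  have "0 \<le> A $ j $ j + 2 * ?t * A $ j $ a"
    using psd_quadratic_ge_0[OF assms(1), of ?x ?t a] assms(2) unfolding xx by simp
  then show False
    using nz by (simp add: field_simps)
qed

text \<open>The form of the reduced matrix at \<open>x\<close> is the minimum over \<open>t\<close>
  of the form of \<open>A\<close> at \<open>x + t *\<^sub>R axis a 1\<close>.\<close>

lemma psd_schur_complement:
  assumes "psd A" "A $ a $ a > 0"
  shows "psd (A - (\<chi> r c. A $ r $ a * A $ c $ a / A $ a $ a))"
    (is "psd (A - ?B)")
  unfolding psd_def
proof (intro conjI allI)
  show "sym_mat (A - ?B)"
    using psd_nth_sym[OF assms(1)] by (simp add: sym_mat_def transpose_def vec_eq_iff)
next
  fix x
  let ?w = "column a A"
  \<comment> \<open>The minimizer of the quadratic in \<open>t\<close>.\<close>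
  let ?t = "- (x \<bullet> ?w) / A $ a $ a"
  have "?B *v x = ((x \<bullet> ?w) / A $ a $ a) *\<^sub>R ?w"
    by (simp add: vec_eq_iff matrix_vector_mult_def inner_vec_def column_def
        sum_distrib_left sum_distrib_right sum_divide_distrib mult_ac)
  then have "x \<bullet> ((A - ?B) *v x) = x \<bullet> (A *v x) - (x \<bullet> ?w)\<^sup>2 / A $ a $ a"
    by (simp add: matrix_vector_mult_diff_rdistrib inner_diff_right power2_eq_square)
  also have "\<dots> = x \<bullet> (A *v x) + 2 * ?t * (x \<bullet> ?w) + ?t\<^sup>2 * A $ a $ a"
    using assms(2) by (simp add: field_simps power2_eq_square)
  also have "\<dots> \<ge> 0"
    by (rule psd_quadratic_ge_0[OF assms(1)])
  finally show "0 \<le> x \<bullet> ((A - ?B) *v x)" .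
qed

text \<open>Cholesky elimination: every step clears one more row and column.\<close>

lemma psd_factor_aux:
  assumes "finite R" "psd A" "\<And>i j. i \<notin> R \<Longrightarrow> A $ i $ j = 0"
  shows "\<exists>(q::nat) v. \<forall>r c. A $ r $ c = (\<Sum>k<q. v r k * v c k)"
  using assms
proof (induction R arbitrary: A rule: finite_induct)
  case empty
  \<comment> \<open>No columns are needed; \<open>0 * 0\<close> gives the summand the shape
    \<open>v r k * v c k\<close> for unification.\<close>
  then have "\<forall>r c. A $ r $ c = (\<Sum>k<0::nat. 0 * 0)" by simp
  then show ?case by fast
next
  case (insert a R)
  show ?case
  proof (cases "A $ a $ a = 0")
    case True
    \<comment> \<open>With a zero pivot, row \<open>a\<close> is already clear and \<open>A\<close>
      itself fits the induction hypothesis.\<close>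
    then have "A $ a $ j = 0" for j
      using psd_zero_diag psd_nth_sym insert.prems(1) by metis
    then show ?thesis
      using insert.IH[OF insert.prems(1)] insert.prems(2) by (metis insertE)
  next
    case False
    then have pos: "A $ a $ a > 0"
      using psd_diag_ge_0[OF insert.prems(1), of a] by simp
    define A' where "A' = A - (\<chi> r c. A $ r $ a * A $ c $ a / A $ a $ a)"
    \<comment> \<open>Row \<open>a\<close> is cleared by symmetry of \<open>A\<close>; rows that
      were zero stay zero, since their entry in column \<open>a\<close> is zero.\<close>
    have "A' $ i $ j = 0" if "i \<notin> R" for i j
      using insert.prems(2)[of i] that False psd_nth_sym[OF insert.prems(1), of a j]
      by (cases "i = a") (auto simp: A'_def)
    moreover have "psd A'"
      unfolding A'_def using insert.prems(1) pos by (rule psd_schur_complement)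
    ultimately obtain q v where v: "\<And>r c. A' $ r $ c = (\<Sum>k<(q::nat). v r k * v c k)"
      using insert.IH by meson
    \<comment> \<open>The new column \<open>q\<close> has as its outer product exactly the rank-one
      matrix removed from \<open>A\<close>.\<close>
    define w where "w r = (v r)(q := A $ r $ a / sqrt (A $ a $ a))" for r
    have "A $ r $ c = (\<Sum>k<Suc q. w r k * w c k)" for r c
    proof -
      have "A $ r $ c = A' $ r $ c + A $ r $ a * A $ c $ a / A $ a $ a"
        by (simp add: A'_def)
      also have "A' $ r $ c = (\<Sum>k<q. w r k * w c k)"
        unfolding v by (intro sum.cong) (auto simp: w_def)
      finally show ?thesis
        using pos by (simp add: w_def)
    qed
    then show ?thesis by blast
  qed
qed

lemma psd_factor:
  assumes "psd A"
  obtains q :: nat and v where "\<And>r c. A $ r $ c = (\<Sum>k<q. v r k * v c k)"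
  using psd_factor_aux[of UNIV A] assms by auto

section \<open>Closure properties of sum-of-squares matrices\<close>

lemma single_sum: "Poly_Mapping.single e (sum f A) = (\<Sum>x\<in>A. Poly_Mapping.single e (f x))"
  by (induction A rule: infinite_finite_induct) (auto simp: single_add)

text \<open>Placing the two factors side by side adds their Gram products; \<open>V\<close> is this
  concatenation.\<close>

lemma sos_mat_add:
  assumes "sos_mat A" "sos_mat B"
  shows "sos_mat (A + B)"
proof -
  obtain p T where A: "A = (\<chi> r c. \<Sum>k<(p::nat). T r k * T c k)"
    using assms(1) by (auto simp: sos_mat_def)
  obtain q U where B: "B = (\<chi> r c. \<Sum>k<(q::nat). U r k * U c k)"
    using assms(2) by (auto simp: sos_mat_def)
  define V where "V r k = (if k < p then T r k else U r (k - p))" for r k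
  have "(\<Sum>k<p + q. V r k * V c k) = (\<Sum>k<p. T r k * T c k) + (\<Sum>k<q. U r k * U c k)" for r c
  proof -
    have "(\<Sum>k<p + q. V r k * V c k) = (\<Sum>k<p. V r k * V c k) + (\<Sum>k<q. V r (p + k) * V c (p + k))"
      by (induction q) (auto simp: add.assoc)
    then show ?thesis by (simp add: V_def)
  qed
  then have "A + B = (\<chi> r c. \<Sum>k<p + q. V r k * V c k)"
    by (simp add: A B vec_eq_iff)
  then show ?thesis
    unfolding sos_mat_def by blast
qed

lemma sos_mat_sum:
  assumes "\<And>i. i \<in> I \<Longrightarrow> sos_mat (A i)"
  shows "sos_mat (sum A I)"
proof -
  have "sos_mat 0"
    unfolding sos_mat_def by (intro exI[of _ "0::nat"]) (simp add: vec_eq_iff)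
  with assms show ?thesis
    by (induction I rule: infinite_finite_induct) (auto intro: sos_mat_add)
qed

text \<open>If \<open>A\<close> is the Gram product of the rows of \<open>v\<close>, scaling each
  entry of \<open>v\<close> by \<open>p\<close> produces the factor.\<close>

lemma sos_mat_square_psd:
  fixes p :: "'m::finite rpoly"
  assumes "psd A"
  shows "sos_mat (\<chi> r c. p * p * Poly_Mapping.single 0 (A $ r $ c))"
proof -
  obtain q :: nat and v where v: "\<And>r c. A $ r $ c = (\<Sum>k<q. v r k * v c k)"
    using psd_factor[OF assms] by blast
  define T where "T r k = p * Poly_Mapping.single 0 (v r k)" for r k
  have "p * p * Poly_Mapping.single 0 (A $ r $ c) = (\<Sum>k<q. T r k * T c k)" for r c
  proof -
    have "Poly_Mapping.single 0 (v r k * v c k)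
        = (Poly_Mapping.single 0 (v r k) * Poly_Mapping.single 0 (v c k) :: 'm rpoly)" for k
      by (simp add: mult_single)
    then show ?thesis
      by (simp add: v single_sum T_def sum_distrib_left mult_ac)
  qed
  then show ?thesis
    unfolding sos_mat_def by auto
qed

section \<open>Evaluation and total degree of polynomials\<close>

lemma poly_eval_superset:
  assumes "finite K" "Poly_Mapping.keys p \<subseteq> K"
  shows "poly_eval p \<delta> =
    (\<Sum>e\<in>K. Poly_Mapping.lookup p e * (\<Prod>i\<in>UNIV. (\<delta> $ i) ^ Poly_Mapping.lookup e i))"
  unfolding poly_eval_def
  using assms by (intro sum.mono_neutral_left) (auto simp: in_keys_iff)

lemma poly_eval_add: "poly_eval (p + q) \<delta> = poly_eval p \<delta> + poly_eval q \<delta>"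
proof -
  let ?K = "Poly_Mapping.keys p \<union> Poly_Mapping.keys q"
  \<comment> \<open>Cancellation may shrink the support of the sum, so all three polynomials are
    evaluated over the common set \<open>?K\<close>.\<close>
  have "Poly_Mapping.keys (p + q) \<subseteq> ?K"
    by (rule Poly_Mapping.keys_add)
  then show ?thesis
    by (simp add: poly_eval_superset[of ?K] lookup_add distrib_right sum.distrib)
qed

lemma poly_eval_sum: "poly_eval (sum f I) \<delta> = (\<Sum>i\<in>I. poly_eval (f i) \<delta>)"
proof -
  have "poly_eval 0 \<delta> = 0"
    by (simp add: poly_eval_def)
  then show ?thesis
    by (induction I rule: infinite_finite_induct) (auto simp: poly_eval_add)
qed

lemma poly_eval_const: "poly_eval (Poly_Mapping.single 0 c) \<delta> = c"
  by (simp add: poly_eval_def)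

lemma poly_eval_var_power:
  "poly_eval (Poly_Mapping.single (Poly_Mapping.single i k) c) \<delta> = c * (\<delta> $ i) ^ k"
proof -
  have "(\<Prod>j\<in>UNIV. (\<delta> $ j) ^ Poly_Mapping.lookup (Poly_Mapping.single i k) j)
      = (\<Prod>j\<in>UNIV. if j = i then (\<delta> $ i) ^ k else 1)"
    by (intro prod.cong) (auto simp: lookup_single when_def)
  then show ?thesis
    by (simp add: poly_eval_def)
qed

lemma total_degree_le_iff:
  "total_degree p \<le> d \<longleftrightarrow>
    (\<forall>e\<in>Poly_Mapping.keys p. (\<Sum>i\<in>UNIV. Poly_Mapping.lookup e i) \<le> d)"
  by (auto simp: total_degree_def)

lemma total_degree_add_le:
  "total_degree p \<le> d \<Longrightarrow> total_degree q \<le> d \<Longrightarrow> total_degree (p + q) \<le> d"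
  using Poly_Mapping.keys_add[of p q] by (auto simp: total_degree_le_iff)

lemma total_degree_sum_le:
  "(\<And>i. i \<in> I \<Longrightarrow> total_degree (f i) \<le> d) \<Longrightarrow> total_degree (sum f I) \<le> d"
  by (induction I rule: infinite_finite_induct)
    (auto intro: total_degree_add_le simp: total_degree_le_iff[of 0])

lemma total_degree_const_le: "total_degree (Poly_Mapping.single 0 c) \<le> d"
  by (simp add: total_degree_le_iff)

lemma total_degree_var_power_le:
  "k \<le> d \<Longrightarrow> total_degree (Poly_Mapping.single (Poly_Mapping.single i k) c) \<le> d"
  by (simp add: total_degree_le_iff lookup_single when_def)

section \<open>The certificate\<close>

lemma affine_square:
  fixes i :: 'm and a b :: real
  defines "p \<equiv> Poly_Mapping.single 0 a + Poly_Mapping.single (Poly_Mapping.single i 1) b"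
  shows "p * p * Poly_Mapping.single 0 c = Poly_Mapping.single 0 (a * a * c)
    + Poly_Mapping.single (Poly_Mapping.single i (1::nat)) (2 * a * b * c)
    + Poly_Mapping.single (Poly_Mapping.single i 2) (b * b * c)"
proof -
  have "Poly_Mapping.single i (1::nat) + Poly_Mapping.single i 1 = Poly_Mapping.single i 2"
    by (simp flip: single_add one_add_one)
  \<comment> \<open>The double product is split into the two cross terms that distributivity
    yields.\<close>
  moreover have "Poly_Mapping.single (Poly_Mapping.single i (1::nat)) (2 * a * b * c)
      = Poly_Mapping.single (Poly_Mapping.single i 1) (a * b * c)
        + Poly_Mapping.single (Poly_Mapping.single i 1) (b * a * c)"
    by (simp add: mult.assoc flip: single_add)
  ultimately show ?thesis
    unfolding p_def by (simp only: distrib_left distrib_right mult_single add_0_left add_0_right add_ac)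
qed

theorem theorem13:
  fixes H0 :: "real ^ 'n ^ 'n" and H :: "'m::finite \<Rightarrow> real ^ 'n ^ 'n"
  assumes "sym_mat H0" and "\<And>i. sym_mat (H i)"
    and "X_T H0 H \<noteq> {}"
  shows "X_3 H0 H \<noteq> {}"
proof -
  obtain X where X: "\<And>i. sym_mat (X i)" "psd (H0 - (\<Sum>i\<in>UNIV. X i))"
      "\<And>i. psd (X i + H i)" "\<And>i. psd (X i - H i)"
    using assms(3) by (auto simp: X_T_def)
  \<comment> \<open>For \<open>b\<close> = 1/2 and -1/2 these are the squares of (1 + delta_i)/2 and
    (1 - delta_i)/2.\<close>
  define sq :: "'m \<Rightarrow> real \<Rightarrow> 'm rpoly" where
    "sq i b = (Poly_Mapping.single 0 (1/2) + Poly_Mapping.single (Poly_Mapping.single i 1) b)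
      * (Poly_Mapping.single 0 (1/2) + Poly_Mapping.single (Poly_Mapping.single i 1) b)" for i b
  define S0 :: "'m rpoly ^ 'n ^ 'n" where
    \<comment> \<open>The factor \<open>1 * 1\<close> lets \<open>sos_mat_square_psd\<close> apply
      with \<open>p = 1\<close>.\<close>
    "S0 = (\<chi> r c. 1 * 1 * Poly_Mapping.single 0 ((H0 - (\<Sum>i\<in>UNIV. X i)) $ r $ c))
      + (\<Sum>i\<in>UNIV. (\<chi> r c. sq i (1/2) * Poly_Mapping.single 0 ((X i + H i) $ r $ c))
        + (\<chi> r c. sq i (-1/2) * Poly_Mapping.single 0 ((X i - H i) $ r $ c)))"
  have sos: "sos_mat S0"
    unfolding S0_def sq_def using X by (intro sos_mat_add sos_mat_sum sos_mat_square_psd)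
  have sq_expand: "sq i (1/2) * Poly_Mapping.single 0 (x + h) + sq i (-1/2) * Poly_Mapping.single 0 (x - h)
    = Poly_Mapping.single 0 (x / 2) + Poly_Mapping.single (Poly_Mapping.single i 1) h
      + Poly_Mapping.single (Poly_Mapping.single i 2) (x / 2)" for i x h
  proof -
    have "Poly_Mapping.single 0 a + Poly_Mapping.single u b + Poly_Mapping.single w c
        + (Poly_Mapping.single 0 a' + Poly_Mapping.single u b' + Poly_Mapping.single w c')
      = Poly_Mapping.single 0 (a + a') + Poly_Mapping.single u (b + b') + Poly_Mapping.single w (c + c')"
      for a b c a' b' c' :: real and u w :: "'m \<Rightarrow>\<^sub>0 nat"
      by (simp add: single_add add_ac)
    \<comment> \<open>These are the coefficients from \<open>affine_square\<close> with
      \<open>a = 1/2\<close> and \<open>b\<close> = 1/2 or -1/2.\<close>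
    note this[of "(x + h) / 4" _ "(x + h) / 2" _ "(x + h) / 4" "(x - h) / 4" "- ((x - h) / 2)" "(x - h) / 4"]
    moreover have "(x + h) / 4 + (x - h) / 4 = x / 2" "(x + h) / 2 + - ((x - h) / 2) = h"
      by (simp_all add: field_simps)
    ultimately show ?thesis
      unfolding sq_def affine_square by simp
  qed
  \<comment> \<open>In monomial form, degree and evaluation can be handled term by term.\<close>
  have S0_nth: "S0 $ r $ c = Poly_Mapping.single 0 ((H0 - (\<Sum>i\<in>UNIV. X i)) $ r $ c)
    + (\<Sum>i\<in>UNIV. Poly_Mapping.single 0 (X i $ r $ c / 2)
      + Poly_Mapping.single (Poly_Mapping.single i 1) (H i $ r $ c)
      + Poly_Mapping.single (Poly_Mapping.single i 2) (X i $ r $ c / 2))" for r c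
    using sq_expand by (simp add: S0_def)
  have "sym_mat S0"
    \<comment> \<open>Every product of the form T times its transpose is symmetric, since
      polynomials commute.\<close>
    using sos by (auto simp: sos_mat_def sym_mat_def transpose_def vec_eq_iff mult.commute)
  moreover have "total_degree (S0 $ r $ c) \<le> 2" for r c
    unfolding S0_nth
    by (intro total_degree_add_le total_degree_sum_le total_degree_const_le
        total_degree_var_power_le) auto
  moreover have "sym_mat ((1/2) *\<^sub>R X i)" for i
    using X(1)[of i] by (simp add: sym_mat_def transpose_def vec_eq_iff)
  moreover have "G H0 H \<delta> = mat_eval S0 \<delta> + (\<Sum>i\<in>UNIV. (1 - (\<delta> $ i)\<^sup>2) *\<^sub>R ((1/2) *\<^sub>R X i))" for \<delta>
  proof -
    have "G H0 H \<delta> $ r $ c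
      = (mat_eval S0 \<delta> + (\<Sum>i\<in>UNIV. (1 - (\<delta> $ i)\<^sup>2) *\<^sub>R ((1/2) *\<^sub>R X i))) $ r $ c" for r c
    proof -
      have "mat_eval S0 \<delta> $ r $ c = H0 $ r $ c - (\<Sum>i\<in>UNIV. X i $ r $ c)
        + (\<Sum>i\<in>UNIV. X i $ r $ c / 2 + H i $ r $ c * \<delta> $ i + X i $ r $ c / 2 * (\<delta> $ i)\<^sup>2)"
        unfolding mat_eval_def
        by (simp add: S0_nth poly_eval_add poly_eval_sum poly_eval_const poly_eval_var_power)
      \<comment> \<open>The constant term -\<open>X i\<close> cancels against one half from
        \<open>S0\<close> and one half from the multiplier; the squares cancel too, leaving the
        terms in \<open>H i\<close>.\<close>
      then show ?thesis
        by (simp add: G_def sum.distrib sum_subtractf algebra_simps flip: sum_divide_distrib)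
    qed
    then show ?thesis
      by (simp add: vec_eq_iff)
  qed
  ultimately have "(S0, \<lambda>i. (1/2) *\<^sub>R X i) \<in> X_3 H0 H"
    unfolding X_3_def using sos by simp
  then show ?thesis by blast
qed

end
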